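(* Let $m$ and $z$ be positive integers and put $X=317z$, $Y=200z$. Then the equation $$X\bigl(X^2+4m^2-1\bigr)=4Y\bigl(Y^2+m^2-1\bigr)$$ is equivalent to $$48329z^2-156m^2=161.$$ Moreover, $(z,m)=(5,88)$ is a positive integer solution of the equation $48329z^2-156m^2=161$. *)

theory Defs imports Main begin

end

theory Submission imports Defs begin

text \<open>Substituting \<open>X = 317 z\<close> and \<open>Y = 200 z\<close> turns the difference of the two sides of the
  cubic equation into \<open>-3 z\<close> times \<open>48329 z\<^sup>2 - 156 m\<^sup>2 - 161\<close>. Since \<open>z\<close> is nonzero, the cubic
  equation holds exactly when the quadratic factor vanishes. That \<open>(5, 88)\<close> is a solution is
  arithmetic: \<open>1208225 - 1208064 = 161\<close>.\<close>

lemma cubic_difference_factorization: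
  fixes m z :: "'a::comm_ring_1"
  shows "317 * z * ((317 * z)^2 + 4 * m^2 - 1) - 4 * (200 * z) * ((200 * z)^2 + m^2 - 1)
           = - 3 * z * (48329 * z^2 - 156 * m^2 - 161)"
  by (simp add: algebra_simps power2_eq_square)

theorem proposition2:
  shows "(\<forall>m z X Y :: int. 0 < m \<longrightarrow> 0 < z \<longrightarrow> X = 317 * z \<longrightarrow> Y = 200 * z \<longrightarrow>
            (X * (X^2 + 4 * m^2 - 1) = 4 * Y * (Y^2 + m^2 - 1)
              \<longleftrightarrow> 48329 * z^2 - 156 * m^2 = 161))
       \<and> (\<forall>z m :: int. (z, m) = (5, 88) \<longrightarrow>
            0 < z \<and> 0 < m \<and> 48329 * z^2 - 156 * m^2 = 161)"
proof (intro conjI allI impI)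
  fix m z X Y :: int
  assume "0 < z" and X: "X = 317 * z" and Y: "Y = 200 * z"
  have "X * (X^2 + 4 * m^2 - 1) = 4 * Y * (Y^2 + m^2 - 1)
          \<longleftrightarrow> X * (X^2 + 4 * m^2 - 1) - 4 * Y * (Y^2 + m^2 - 1) = 0"
    by (rule eq_iff_diff_eq_0)
  also have "\<dots> \<longleftrightarrow> - 3 * z * (48329 * z^2 - 156 * m^2 - 161) = 0"
    unfolding X Y cubic_difference_factorization ..
  also have "\<dots> \<longleftrightarrow> 48329 * z^2 - 156 * m^2 - 161 = 0"
    using \<open>0 < z\<close> by simp
  also have "\<dots> \<longleftrightarrow> 48329 * z^2 - 156 * m^2 = 161"
    by (rule eq_iff_diff_eq_0[symmetric])
  finally show "X * (X^2 + 4 * m^2 - 1) = 4 * Y * (Y^2 + m^2 - 1)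
                  \<longleftrightarrow> 48329 * z^2 - 156 * m^2 = 161" .
qed simp_all

end
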